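(* Let $G$ be a transitive permutation group on a set $\Omega$ of cardinality $n\geq 2$ and let $A$ be a generating set for $G$. Suppose that $B\subseteq T(\Omega)$ is such that the monoid $\langle G\cup B\rangle$ is synchronizing. Then there is a reset word over $A\cup B$ of length at most \[1+(n-m+d_A(G))(n-2),\] where $m$ is the maximum dimension of an irreducible $\mathbb{Q}G$-submodule of $\mathbb{Q}^{\Omega}$. In particular, in the case that $m\geq d_A(G)$, there is a reset word over $A\cup B$ of length at most $(n-1)^2$.
   Context: Here $T(\Omega)$ is the monoid of all maps $\Omega\to\Omega$ under composition, with maps written on the right of their arguments. A transformation monoid on $\Omega$ (a submonoid of $T(\Omega)$) is synchronizing if it contains a map of rank $1$ (a constant map). $\langle G\cup B\rangle$ is the submonoid of $T(\Omega)$ generated by $G$ and $B$. A reset word over a set $X\subseteq T(\Omega)$ is a finite sequence of elements of $X$ whose product (composition) is a constant map; its length is the number of terms of the sequence. For a finite group $G$ with generating set $A$, $d_A(G)$ is the smallest integer $d\ge 0$ such that $G=(A\cup\{1\})^d$, i.e. every element of $G$ is a product of at most $d$ elements of $A$ (inverses not allowed). $\mathbb{Q}^{\Omega}$ is the $\mathbb{Q}$-vector space of all functions $f:\Omega\to\mathbb{Q}$, a left $\mathbb{Q}G$-module via $(gf)(x)=f(xg)$ for $g\in G$, $x\in\Omega$. *)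

theory Defs
  imports
    "HOL-Analysis.Analysis"
    "HOL-Algebra.Generated_Groups"
    "HOL-Algebra.Group_Action"
begin

text \<open>
  The finite set acted upon is a type of class \<open>finite\<close>, so that its full transformation
  monoid is the type of all self-maps.  Maps act on the right in the source: the product of the
  word \<open>[f\<^sub>1, \<dots>, f\<^sub>k]\<close> applies \<open>f\<^sub>1\<close> first.
\<close>

definition word_map :: "('a \<Rightarrow> 'a) list \<Rightarrow> 'a \<Rightarrow> 'a" where
  "word_map w x = fold (\<lambda>f y. f y) w x"

definition reset_word :: "('a \<Rightarrow> 'a) set \<Rightarrow> ('a \<Rightarrow> 'a) list \<Rightarrow> bool" where
  "reset_word X w \<longleftrightarrow> set w \<subseteq> X \<and> word_map w constant_on UNIV"

inductive_set gen_monoid :: "('a \<Rightarrow> 'a) set \<Rightarrow> ('a \<Rightarrow> 'a) set" for X where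
  one: "id \<in> gen_monoid X"
| incl: "f \<in> X \<Longrightarrow> f \<in> gen_monoid X"
| mult: "f \<in> gen_monoid X \<Longrightarrow> g \<in> gen_monoid X \<Longrightarrow> g \<circ> f \<in> gen_monoid X"

definition synchronizing :: "('a::finite \<Rightarrow> 'a) set \<Rightarrow> bool" where
  "synchronizing M \<longleftrightarrow> (\<exists>f\<in>M. card (range f) = 1)"

text \<open>
  Subgroups of \<open>BijGroup UNIV\<close> are the permutation groups.  Its multiplication is
  \<open>g \<otimes> f = g \<circ> f\<close>, opposite to the right-action convention; this affects neither which sets
  are subgroups nor which subgroup a set generates.
\<close>

definition transitive_perm_group :: "('a::finite \<Rightarrow> 'a) set \<Rightarrow> bool" where
  "transitive_perm_group G \<longleftrightarrow> subgroup G (BijGroup UNIV)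
     \<and> transitive_action (BijGroup UNIV\<lparr>carrier := G\<rparr>) UNIV (\<lambda>g. g)"

text \<open>
  \<open>(A \<union> {1})\<^sup>d\<close>, and the least \<open>d\<close> for which it is \<open>G\<close>.  No inverses are taken.
  Such a \<open>d\<close> exists whenever \<open>A\<close> generates the finite group \<open>G\<close> (lemma \<open>gen_diameter\<close> below).
\<close>

definition word_power :: "('a \<Rightarrow> 'a) set \<Rightarrow> nat \<Rightarrow> ('a \<Rightarrow> 'a) set" where
  "word_power A d = {word_map w |w. length w = d \<and> set w \<subseteq> A \<union> {id}}"

definition gen_diameter :: "('a::finite \<Rightarrow> 'a) set \<Rightarrow> ('a \<Rightarrow> 'a) set \<Rightarrow> nat" where
  "gen_diameter A G = (LEAST d. G = word_power A d)"

text \<open>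
  The permutation module is \<open>rat ^ 'a\<close> with \<open>(gf)(x) = f(xg)\<close>.  As the action of the group ring
  is the linear extension of that of \<open>G\<close>, its submodules are the \<open>G\<close>-invariant subspaces.
\<close>

definition perm_act :: "('a::finite \<Rightarrow> 'a) \<Rightarrow> rat ^ 'a \<Rightarrow> rat ^ 'a" where
  "perm_act g f = (\<chi> x. f $ g x)"

definition QG_submodule :: "('a::finite \<Rightarrow> 'a) set \<Rightarrow> (rat ^ 'a) set \<Rightarrow> bool" where
  "QG_submodule G W \<longleftrightarrow> vec.subspace W \<and> (\<forall>g\<in>G. \<forall>f\<in>W. perm_act g f \<in> W)"

definition irreducible_QG_submodule :: "('a::finite \<Rightarrow> 'a) set \<Rightarrow> (rat ^ 'a) set \<Rightarrow> bool" where
  "irreducible_QG_submodule G W \<longleftrightarrow> QG_submodule G W \<and> W \<noteq> {0}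
     \<and> (\<forall>U. QG_submodule G U \<and> U \<subseteq> W \<longrightarrow> U = {0} \<or> U = W)"

definition max_irreducible_dim :: "('a::finite \<Rightarrow> 'a) set \<Rightarrow> nat" where
  "max_irreducible_dim G = Max {vec.dim W |W. irreducible_QG_submodule G W}"

text \<open>The maximum and the minimum above are attained.\<close>

lemma max_irreducible_dim:
  fixes G :: "('a::finite \<Rightarrow> 'a) set"
  shows "finite {vec.dim W |W. irreducible_QG_submodule G W}"
    and "{vec.dim W |W. irreducible_QG_submodule G W} \<noteq> {}"
proof -
  have "{vec.dim W |W. irreducible_QG_submodule G W} \<subseteq> {..CARD('a)}"
    using dim_subset_UNIV_cart_gen by auto
  then show "finite {vec.dim W |W. irreducible_QG_submodule G W}"
    using finite_subset by blast
  define P where "P W \<longleftrightarrow> QG_submodule G W \<and> W \<noteq> {0}" for W :: "(rat ^ 'a) set"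
  have "(1 :: rat ^ 'a) \<noteq> 0"
    by (simp add: vec_eq_iff)
  then have "P UNIV"
    unfolding P_def QG_submodule_def by (metis UNIV_I singletonD vec.subspace_UNIV)
  then obtain W where W: "P W" and least: "\<And>U. P U \<Longrightarrow> vec.dim W \<le> vec.dim U"
    using arg_min_nat_lemma[of P UNIV vec.dim] by blast
  have "U = {0} \<or> U = W" if "QG_submodule G U" "U \<subseteq> W" for U
    using that W least[of U] vec.subspace_dim_equal[of U W]
    unfolding P_def QG_submodule_def by blast
  then show "{vec.dim W |W. irreducible_QG_submodule G W} \<noteq> {}"
    using W unfolding P_def irreducible_QG_submodule_def by blast
qed

lemma gen_diameter:
  fixes A G :: "('a::finite \<Rightarrow> 'a) set"
  assumes G: "subgroup G (BijGroup UNIV)" and gen: "generate (BijGroup UNIV) A = G"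
  shows "G = word_power A (gen_diameter A G)"
proof -
  have inG: "bij g" if "g \<in> G" for g
    using subgroup.subset[OF G] that by (auto simp: BijGroup_def Bij_def)
  have AG: "A \<subseteq> G"
    using gen generate.incl[of _ A] by blast
  have idG: "id \<in> G"
    using subgroup.one_closed[OF G] by (simp add: BijGroup_def id_def restrict_UNIV)
  have compG: "g \<circ> f \<in> G" if "g \<in> G" "f \<in> G" for f g
    using subgroup.m_closed[OF G that] inG that
    by (simp add: BijGroup_def Bij_def compose_def o_def restrict_UNIV)
  have wG: "word_map w \<in> G" if "set w \<subseteq> A \<union> {id}" for w
    using that
  proof (induction w)
    case Nil
    then show ?case using idG by (simp add: word_map_def[abs_def] id_def)
  next
    case (Cons a w)
    have "word_map (a # w) = word_map w \<circ> a"
      by (auto simp: word_map_def)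
    moreover have "a \<in> G" "word_map w \<in> G"
      using Cons AG idG by (auto simp: id_def)
    ultimately show ?case using compG by metis
  qed
  define S where "S = {word_map w |w. set w \<subseteq> A}"
  have S_iff: "f \<in> S \<longleftrightarrow> (\<exists>w. f = word_map w \<and> set w \<subseteq> A)" for f
    by (simp add: S_def)
  have S_id: "id \<in> S"
    unfolding S_def by (rule CollectI, rule exI[of _ "[]"]) (auto simp: word_map_def)
  have S_comp: "g \<circ> f \<in> S" if fg: "g \<in> S" "f \<in> S" for f g
  proof -
    obtain v w where "g = word_map v" "set v \<subseteq> A" "f = word_map w" "set w \<subseteq> A"
      using fg by (auto simp: S_iff)
    then have "g \<circ> f = word_map (w @ v)" "set (w @ v) \<subseteq> A"
      by (auto simp: word_map_def)
    then show ?thesis by (metis S_iff)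
  qed
  have S_A: "a \<in> S" if "a \<in> A" for a
    unfolding S_def using that by (intro CollectI exI[of _ "[a]"]) (auto simp: word_map_def)
  have S_pow: "f ^^ k \<in> S" if "f \<in> S" for f and k :: nat
    by (induction k) (metis funpow_0 S_id eq_id_iff, metis funpow.simps(2) S_comp that)
  have S_inv: "inv_into UNIV f \<in> S" if "f \<in> S" "bij f" for f
  proof -
    have "\<not> inj (\<lambda>k::nat. f ^^ k)"
      using finite_imageD[of "\<lambda>k::nat. f ^^ k" UNIV] by (metis finite_class.finite infinite_UNIV_nat)
    then obtain i j :: nat where ij: "i < j" "f ^^ i = f ^^ j"
      unfolding inj_def by (metis linorder_neqE_nat)
    have "(f ^^ i) ((f ^^ (j - i)) x) = (f ^^ i) x" for x
      using ij funpow_add[of i "j - i" f] by (metis add_diff_inverse_nat comp_apply less_imp_not_less)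
    moreover have "inj (f ^^ i)"
      using that(2) by (simp add: bij_is_inj inj_fn)
    ultimately have id: "f ^^ Suc (j - i - 1) = id"
      using ij(1) by (simp add: inj_eq fun_eq_iff Suc_diff_Suc del: funpow.simps)
    have "inv_into UNIV f = f ^^ (j - i - 1)"
      by (rule inv_unique_comp) (metis id funpow.simps(2), metis id funpow_Suc_right)
    then show ?thesis using S_pow that by simp
  qed
  have "g \<in> S" if "g \<in> generate (BijGroup UNIV) A" for g
    using that
  proof (induction g rule: generate.induct)
    case one
    then show ?case using S_id by (simp add: BijGroup_def id_def restrict_UNIV)
  next
    case (incl h)
    then show ?case using S_A by simp
  next
    case (inv h)
    then have "h \<in> Bij UNIV"
      using AG inG by (auto simp: Bij_def)
    then show ?case
      using inv S_inv S_A AG inG by (auto simp: inv_BijGroup restrict_UNIV)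
  next
    case (eng h1 h2)
    then have "h1 \<in> Bij UNIV" "h2 \<in> Bij UNIV"
      using gen inG by (auto simp: Bij_def)
    then show ?case
      using S_comp[of h1 h2] eng by (simp add: BijGroup_def compose_def o_def restrict_UNIV)
  qed
  then have "\<forall>g\<in>G. \<exists>w. word_map w = g \<and> set w \<subseteq> A"
    using gen by (metis S_iff)
  then obtain W where W: "\<And>g. g \<in> G \<Longrightarrow> word_map (W g) = g \<and> set (W g) \<subseteq> A"
    by metis
  define d where "d = Max ((length \<circ> W) ` G)"
  have "g \<in> word_power A d" if "g \<in> G" for g
  proof -
    have le: "length (W g) \<le> d"
      unfolding d_def using that by (intro Max_ge) auto
    have pad: "fold (\<lambda>f y. f y) (replicate k id) x = x" for k and x :: 'a
      by (induction k) auto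
    have "word_map (W g @ replicate (d - length (W g)) id) = g"
      using W[OF that] pad by (auto simp: word_map_def fun_eq_iff)
    then show ?thesis
      unfolding word_power_def using W[OF that] le
      by (intro CollectI exI[of _ "W g @ replicate (d - length (W g)) id"]) auto
  qed
  then have "G = word_power A d"
    using wG unfolding word_power_def by blast
  then show ?thesis
    unfolding gen_diameter_def by (rule LeastI)
qed

end

theory Submission
  imports Defs
begin

text \<open>
  A preimage \<open>S\<close> of a point that is neither empty nor everything is represented by
  \<open>f = 1\<^sub>S - |S|/n\<close>, and a word \<open>w\<close> enlarges it exactly when \<open>\<langle>1, w f\<rangle> > 0\<close>.  Let \<open>t\<close> be
  minimal such that \<open>\<langle>1, u g v f\<rangle> \<noteq> 0\<close> for some words \<open>u\<close>, \<open>v\<close> of total length \<open>t\<close> and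
  some \<open>g \<in> G\<close>.  By transitivity these numbers sum to \<open>0\<close> over \<open>g \<in> G\<close> (after arranging
  that \<open>u\<close> is nonempty), so one of them is positive, and \<open>S\<close> is enlarged by a word of length at
  most \<open>t + d\<close>.

  To see \<open>t + m \<le> n\<close>, let \<open>P\<^sub>j\<close> and \<open>Q\<^sub>k\<close> be the submodules generated by the vectors \<open>1 u\<close>
  with \<open>|u| \<le> j\<close> and \<open>v f\<close> with \<open>|v| \<le> k\<close>.  They are orthogonal if \<open>j + k < t\<close>, and
  their dimensions exceed \<open>j\<close> and \<open>k\<close>.  Fix an irreducible submodule \<open>W\<close> of dimension \<open>m\<close>.
  At the first \<open>j < t\<close> where \<open>P\<^sub>j\<close> is not orthogonal to \<open>W\<close>, its dimension jumps by at least
  \<open>m\<close>, so \<open>(j + m) + (t - j) \<le> dim P\<^sub>j + dim Q\<^bsub>t-1-j\<^esub> \<le> n\<close>.  If there is no such \<open>j\<close>, then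
  \<open>P\<^bsub>t-1\<^esub>\<close> and \<open>Q\<^sub>0\<close> give the bound, whether or not \<open>Q\<^sub>0\<close> is orthogonal to \<open>W\<close>.
\<close>

section \<open>Orthogonality and dimension over the rationals\<close>

definition rdot :: "rat ^ 'a::finite \<Rightarrow> rat ^ 'a \<Rightarrow> rat" where
  "rdot x y = (\<Sum>i\<in>UNIV. x $ i * y $ i)"

lemma rdot_commute: "rdot x y = rdot y x"
  by (simp add: rdot_def mult.commute)

lemma rdot_add_left: "rdot (x + y) z = rdot x z + rdot y z"
  by (simp add: rdot_def sum.distrib algebra_simps)

lemma rdot_diff_left: "rdot (x - y) z = rdot x z - rdot y z"
  by (simp add: rdot_def sum_subtractf algebra_simps)

lemma rdot_scale_left: "rdot (c *s x) z = c * rdot x z"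
  by (simp add: rdot_def sum_distrib_left algebra_simps)

lemma rdot_zero_left [simp]: "rdot 0 x = 0"
  by (simp add: rdot_def)

lemma rdot_zero_right [simp]: "rdot x 0 = 0"
  by (simp add: rdot_def)

lemma rdot_self_eq_0_iff [simp]: "rdot x x = 0 \<longleftrightarrow> x = 0"
  by (simp add: rdot_def sum_nonneg_eq_0_iff vec_eq_iff)

lemma subspace_orthogonal_complement: "vec.subspace {x. \<forall>y\<in>Y. rdot x y = 0}"
  by (auto simp: vec.subspace_def rdot_add_left rdot_scale_left)

lemma rdot_span_eq_0:
  assumes "\<And>x y. x \<in> X \<Longrightarrow> y \<in> Y \<Longrightarrow> rdot x y = 0" "x \<in> vec.span X" "y \<in> vec.span Y"
  shows "rdot x y = 0"
proof -
  \<comment> \<open>Extends orthogonality on one side only; it is applied to \<open>X\<close> first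
    and then, with the roles swapped, to \<open>Y\<close>.\<close>
  have half: "\<forall>y\<in>Y. rdot x y = 0" if "\<And>x y. x \<in> X \<Longrightarrow> y \<in> Y \<Longrightarrow> rdot x y = 0" "x \<in> vec.span X"
    for X Y :: "(rat ^ 'a) set" and x
    using vec.span_minimal[OF _ subspace_orthogonal_complement[of Y], of X] that by blast
  have "rdot y' x = 0" if "y' \<in> Y" for y'
    using half[OF assms(1,2)] that rdot_commute[of y' x] by simp
  then show ?thesis
    using half[of Y "{x}" y] assms(3) by (simp add: rdot_commute)
qed

lemma dim_sum_orthogonal:
  assumes "vec.subspace U" "vec.subspace W" "\<And>u w. u \<in> U \<Longrightarrow> w \<in> W \<Longrightarrow> rdot u w = 0"
  shows "vec.dim {u + w |u w. u \<in> U \<and> w \<in> W} = vec.dim U + vec.dim W"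
proof -
  have "x = 0" if "x \<in> U \<inter> W" for x
    using assms(3)[of x x] that by simp
  then have "vec.dim (U \<inter> W) = 0"
    by auto
  then show ?thesis
    using vec.dim_sums_Int[OF assms(1,2)] by linarith
qed

lemma dim_orthogonal3_le:
  fixes U V W :: "(rat ^ 'a::finite) set"
  assumes "vec.subspace U" "vec.subspace V" "vec.subspace W"
    and "\<And>u v. u \<in> U \<Longrightarrow> v \<in> V \<Longrightarrow> rdot u v = 0"
    and "\<And>u w. u \<in> U \<Longrightarrow> w \<in> W \<Longrightarrow> rdot u w = 0"
    and "\<And>v w. v \<in> V \<Longrightarrow> w \<in> W \<Longrightarrow> rdot v w = 0"
  shows "vec.dim U + vec.dim V + vec.dim W \<le> CARD('a)"
proof -
  let ?S = "{u + v |u v. u \<in> U \<and> v \<in> V}"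
  have "vec.dim {s + w |s w. s \<in> ?S \<and> w \<in> W} = vec.dim ?S + vec.dim W"
    by (rule dim_sum_orthogonal) (use assms vec.subspace_sums in \<open>auto simp: rdot_add_left\<close>)
  then show ?thesis
    using dim_sum_orthogonal[OF assms(1,2,4)]
      dim_subset_UNIV_cart_gen[of "{s + w |s w. s \<in> ?S \<and> w \<in> W}"] by linarith
qed

lemma dim_le_dim_hyperplane_Int:
  assumes "vec.subspace X"
  shows "vec.dim X \<le> vec.dim {x \<in> X. rdot x b = 0} + 1"
proof (cases "\<forall>x\<in>X. rdot x b = 0")
  case True
  then have "{x \<in> X. rdot x b = 0} = X" by blast
  then show ?thesis by simp
next
  case False
  then obtain a where a: "a \<in> X" "rdot a b \<noteq> 0" by blast
  let ?H = "{x \<in> X. rdot x b = 0}"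
  have "x \<in> vec.span (insert a ?H)" if "x \<in> X" for x
  proof -
    let ?c = "rdot x b / rdot a b"
    have "x - ?c *s a \<in> ?H"
      using that a assms
      by (simp add: vec.subspace_diff vec.subspace_scale rdot_diff_left rdot_scale_left)
    then show ?thesis
      unfolding vec.span_insert by (blast intro: vec.span_base[of _ ?H])
  qed
  then have "vec.dim X \<le> vec.dim (insert a ?H)"
    by (intro vec.dim_mono) auto
  then show ?thesis
    by (auto simp: vec.dim_insert split: if_splits)
qed

lemma dim_le_dim_annihilator_add_card:
  assumes "finite B" "vec.subspace X"
  shows "vec.dim X \<le> vec.dim {x \<in> X. \<forall>b\<in>B. rdot x b = 0} + card B"
  using assms
proof (induction B rule: finite_induct)
  case (insert b B)
  let ?Y = "{x \<in> X. \<forall>b\<in>B. rdot x b = 0}"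
  have "vec.subspace ?Y"
    using vec.subspace_inter[OF insert.prems subspace_orthogonal_complement[of B]]
    by (simp add: Collect_conj_eq)
  from dim_le_dim_hyperplane_Int[OF this, of b] insert show ?case
    by (simp add: conj_ac)
qed simp

text \<open>A basis of \<open>U\<close> imposes \<open>vec.dim U\<close> linear conditions on
  \<open>X\<close>, and only 0 satisfies them all.\<close>

lemma dim_le_dim_if_separated:
  assumes "vec.subspace X" "vec.subspace U"
    and "\<And>x. x \<in> X \<Longrightarrow> (\<forall>u\<in>U. rdot x u = 0) \<Longrightarrow> x = 0"
  shows "vec.dim X \<le> vec.dim U"
proof -
  obtain B where B: "finite B" "vec.span B = U" "card B = vec.dim U"
    using vec.basis_subspace_exists[OF assms(2)] by metis
  have "x = 0" if "x \<in> X" "\<forall>b\<in>B. rdot x b = 0" for x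
    using assms(3) rdot_span_eq_0[of "{x}" B] that B(2) by (auto simp: vec.span_base)
  then have "vec.dim {x \<in> X. \<forall>b\<in>B. rdot x b = 0} = 0"
    by auto
  then show ?thesis
    using dim_le_dim_annihilator_add_card[OF B(1) assms(1)] B(3) by linarith
qed

section \<open>Growth of dimension along words\<close>

text \<open>With \<open>foldr\<close> a word acts through \<open>perm_act\<close> as its
  \<open>word_map\<close> does. Bounding the length, not fixing it, makes the sets increase with
  \<open>k\<close>.\<close>

definition reach :: "('b \<Rightarrow> rat ^ 'a \<Rightarrow> rat ^ 'a::finite) \<Rightarrow> 'b set \<Rightarrow> rat ^ 'a \<Rightarrow> nat \<Rightarrow> (rat ^ 'a) set"
  where "reach F X v k = {foldr F w v |w. set w \<subseteq> X \<and> length w \<le> k}"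

lemma reach_mono: "j \<le> k \<Longrightarrow> reach F X v j \<subseteq> reach F X v k"
  unfolding reach_def by fastforce

text \<open>The spans grow strictly until they leave \<open>C\<close>: once two consecutive ones agree, they
  are invariant.\<close>

lemma less_dim_reach:
  assumes lin: "\<And>a. Vector_Spaces.linear (*s) (*s) (F a)"
    and C: "vec.subspace C" "reach F X v k \<subseteq> C"
    and w: "set w \<subseteq> X" "foldr F w v \<notin> C"
  shows "k < vec.dim (reach F X v k)"
  using C(2)
proof (induction k)
  case 0
  \<comment> \<open>Linear maps fix 0, so \<open>v = 0\<close> would keep every word inside
    \<open>C\<close>.\<close>
  have "foldr F u 0 = 0" for u
    by (induction u) (auto simp: vec.linear_0[OF lin])
  then have "v \<noteq> 0"
    using w(2) vec.subspace_0[OF C(1)] by metis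
  moreover have "reach F X v 0 = {v}"
    by (auto simp: reach_def)
  ultimately show ?case by simp
next
  case (Suc k)
  let ?E = "\<lambda>k. vec.span (reach F X v k)"
  have sub: "?E k \<subseteq> ?E (Suc k)"
    by (intro vec.span_mono reach_mono) simp
  have "?E k \<noteq> ?E (Suc k)"
  proof
    assume eq: "?E k = ?E (Suc k)"
    have step: "F a x \<in> ?E k" if "a \<in> X" "x \<in> ?E k" for a x
    proof -
      have "F a ` reach F X v k \<subseteq> reach F X v (Suc k)"
      proof
        fix y assume "y \<in> F a ` reach F X v k"
        then obtain u where "set u \<subseteq> X" "length u \<le> k" "y = foldr F (a # u) v"
          by (auto simp: reach_def)
        then show "y \<in> reach F X v (Suc k)"
          unfolding reach_def using that(1) by (intro CollectI exI[of _ "a # u"]) auto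
      qed
      then have "F a ` ?E k \<subseteq> ?E (Suc k)"
        unfolding vec.linear_span_image[OF lin, symmetric] by (rule vec.span_mono)
      then show ?thesis
        using that eq by blast
    qed
    have "foldr F u v \<in> ?E k" if "set u \<subseteq> X" for u
      using that
    proof (induction u)
      case Nil
      have "v \<in> reach F X v k"
        unfolding reach_def by (intro CollectI exI[of _ "[]"]) auto
      then show ?case by (simp add: vec.span_base)
    qed (auto intro: step)
    then show False
      using w vec.span_minimal[OF Suc.prems C(1)] eq by blast
  qed
  then have "vec.dim (reach F X v k) < vec.dim (reach F X v (Suc k))"
    using sub by (intro vec.dim_psubset) blast
  moreover have "reach F X v k \<subseteq> C"
    using Suc.prems reach_mono[of k "Suc k" F X v] by auto
  ultimately show ?case
    using Suc.IH by simp
qed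

section \<open>Maps acting on rational vectors\<close>

text \<open>The transpose of \<^const>\<open>perm_act\<close>.\<close>

definition push :: "('a::finite \<Rightarrow> 'a) \<Rightarrow> rat ^ 'a \<Rightarrow> rat ^ 'a" where
  "push t h = (\<chi> y. \<Sum>x | t x = y. h $ x)"

lemma rdot_push: "rdot (push t h) f = rdot h (perm_act t f)"
proof -
  have "rdot (push t h) f = (\<Sum>y\<in>UNIV. \<Sum>x | x \<in> UNIV \<and> t x = y. h $ x * f $ t x)"
    by (simp add: rdot_def push_def sum_distrib_right)
  also have "\<dots> = (\<Sum>x\<in>UNIV. h $ x * f $ t x)"
    by (rule sum.group) auto
  finally show ?thesis
    by (simp add: rdot_def perm_act_def)
qed

lemma rdot_foldr_push: "rdot (foldr push u h) f = rdot h (foldr perm_act (rev u) f)"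
  by (induction u arbitrary: f) (auto simp: rdot_push)

lemma perm_act_comp: "perm_act f (perm_act g x) = perm_act (g \<circ> f) x"
  by (simp add: perm_act_def)

lemma foldr_perm_act: "foldr perm_act w f = perm_act (word_map w) f"
  by (induction w) (auto simp: perm_act_def word_map_def)

lemma linear_perm_act: "Vector_Spaces.linear (*s) (*s) (perm_act g)"
  by unfold_locales (auto simp: perm_act_def vec_eq_iff algebra_simps)

lemma linear_push: "Vector_Spaces.linear (*s) (*s) (push g)"
  by unfold_locales (auto simp: push_def vec_eq_iff algebra_simps sum.distrib sum_distrib_left)

lemma rdot_perm_act:
  assumes "bij g"
  shows "rdot (perm_act g x) (perm_act g y) = rdot x y"
  unfolding rdot_def perm_act_def
  using sum.reindex_bij_betw[OF assms, of "\<lambda>i. x $ i * y $ i"] by simp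

section \<open>Transitive permutation groups\<close>

locale transitive_perms =
  fixes G :: "('a::finite \<Rightarrow> 'a) set"
  assumes bij: "g \<in> G \<Longrightarrow> bij g"
    and id_mem: "id \<in> G"
    and comp_mem: "g \<in> G \<Longrightarrow> f \<in> G \<Longrightarrow> g \<circ> f \<in> G"
    and inv_mem: "g \<in> G \<Longrightarrow> inv_into UNIV g \<in> G"
    and transitive: "\<exists>g\<in>G. g x = y"
begin

lemma rdot_perm_act_right:
  assumes "g \<in> G"
  shows "rdot x (perm_act g y) = rdot (perm_act (inv_into UNIV g) x) y"
proof -
  have "perm_act g (perm_act (inv_into UNIV g) x) = x"
    using bij[OF assms] by (simp add: perm_act_comp bij_is_inj perm_act_def)
  then show ?thesis
    using rdot_perm_act[OF bij[OF assms], of "perm_act (inv_into UNIV g) x" y] by simp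
qed

text \<open>Right translation by \<open>k\<close> permutes \<open>G\<close>, so by transitivity the
  sum is the same at every point. Over all points these sums total 0, because each \<open>g\<close>
  is a bijection.\<close>

lemma sum_perm_act_eq_0:
  fixes h :: "rat ^ 'a"
  assumes "sum (($) h) UNIV = 0"
  shows "(\<Sum>g\<in>G. h $ g x) = 0"
proof -
  define c where "c = (\<Sum>g\<in>G. h $ g x)"
  have const: "(\<Sum>g\<in>G. h $ g y) = c" for y
  proof -
    obtain k where k: "k \<in> G" "k x = y"
      using transitive by blast
    have k_inv: "k \<circ> inv_into UNIV k = id" "inv_into UNIV k \<circ> k = id"
      using bij[OF k(1)] by (simp_all add: bij_is_inj bij_is_surj surj_iff[symmetric])
    have "bij_betw (\<lambda>g. g \<circ> k) G G"
      by (rule bij_betw_byWitness[where f' = "\<lambda>g. g \<circ> inv_into UNIV k"])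
        (use k comp_mem inv_mem in \<open>auto simp: comp_assoc k_inv\<close>)
    from sum.reindex_bij_betw[OF this, of "\<lambda>g. h $ g x"] show ?thesis
      using k(2) by (simp add: c_def)
  qed
  have "of_nat CARD('a) * c = (\<Sum>y\<in>UNIV. \<Sum>g\<in>G. h $ g y)"
    unfolding const by simp
  also have "\<dots> = (\<Sum>g\<in>G. \<Sum>y\<in>UNIV. h $ g y)"
    by (rule sum.swap)
  also have "\<dots> = 0"
    using sum.reindex_bij_betw[OF bij, of _ "($) h"] assms by simp
  finally show ?thesis by (simp add: c_def)
qed

section \<open>Irreducible submodules and orthogonal chains\<close>

text \<open>By irreducibility the part of \<open>W\<close> orthogonal to \<open>U\<close> is 0.
  Hence no nonzero element of the orthogonal sum of \<open>K\<close> and \<open>W\<close> is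
  orthogonal to \<open>U\<close>, which bounds its dimension although \<open>W\<close> need not lie
  in \<open>U\<close>.\<close>

lemma irreducible_dim_add_le:
  assumes W: "irreducible_QG_submodule G W" and U: "QG_submodule G U"
    and nonorth: "u \<in> U" "w \<in> W" "rdot u w \<noteq> 0"
    and K: "vec.subspace K" "K \<subseteq> U" "\<And>k w. k \<in> K \<Longrightarrow> w \<in> W \<Longrightarrow> rdot k w = 0"
  shows "vec.dim K + vec.dim W \<le> vec.dim U"
proof -
  have sub: "vec.subspace W" "vec.subspace U"
    using W U by (auto simp: irreducible_QG_submodule_def QG_submodule_def)
  let ?Y = "W \<inter> {x. \<forall>u\<in>U. rdot x u = 0}"
  have "perm_act g x \<in> ?Y" if "g \<in> G" "x \<in> ?Y" for g x
  proof -
    have "rdot (perm_act g x) u = 0" if "u \<in> U" for u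
    proof -
      have "rdot (perm_act g x) u = rdot x (perm_act (inv_into UNIV g) u)"
        using rdot_perm_act_right[OF inv_mem[OF \<open>g \<in> G\<close>]] bij[OF \<open>g \<in> G\<close>]
        by (simp add: inv_inv_eq)
      then show ?thesis
        using U inv_mem that \<open>g \<in> G\<close> \<open>x \<in> ?Y\<close> by (auto simp: QG_submodule_def)
    qed
    then show ?thesis
      using that W by (auto simp: irreducible_QG_submodule_def QG_submodule_def)
  qed
  then have "QG_submodule G ?Y"
    using vec.subspace_inter[OF sub(1) subspace_orthogonal_complement]
    by (auto simp: QG_submodule_def)
  then have "?Y = {0} \<or> ?Y = W"
    using W by (auto simp: irreducible_QG_submodule_def)
  moreover have "w \<notin> ?Y"
    using nonorth by (auto simp: rdot_commute)
  ultimately have Y: "?Y = {0}"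
    using nonorth by blast
  let ?X = "{k + w |k w. k \<in> K \<and> w \<in> W}"
  have "vec.dim ?X \<le> vec.dim U"
  proof (rule dim_le_dim_if_separated[OF vec.subspace_sums[OF K(1) sub(1)] sub(2)])
    fix x assume "x \<in> ?X" and orth: "\<forall>u\<in>U. rdot x u = 0"
    then obtain k w where kw: "x = k + w" "k \<in> K" "w \<in> W" by blast
    \<comment> \<open>Testing \<open>x\<close> against \<open>k\<close>, which lies in
      \<open>U\<close>, leaves only \<open>rdot k k\<close>.\<close>
    have "rdot k w = 0"
      using K(3) kw by blast
    moreover have "rdot x k = 0"
      using orth kw(2) K(2) by blast
    ultimately have "rdot k k = 0"
      by (simp add: kw(1) rdot_add_left rdot_commute[of w k])
    then have "k = 0" by simp
    then have "w \<in> ?Y"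
      using kw orth by auto
    then show "x = 0"
      using Y kw \<open>k = 0\<close> by auto
  qed
  then show ?thesis
    using dim_sum_orthogonal[OF K(1) sub(1) K(3)] by simp
qed

lemma orthogonal_chains_bound:
  assumes W: "irreducible_QG_submodule G W"
    and P: "\<And>j. QG_submodule G (P j)" and Q: "\<And>j. QG_submodule G (Q j)"
    and P_mono: "\<And>j. P j \<subseteq> P (Suc j)"
    and P_dim: "\<And>j. j < t \<Longrightarrow> j < vec.dim (P j)" and Q_dim: "\<And>j. j < t \<Longrightarrow> j < vec.dim (Q j)"
    and orth: "\<And>j k x y. j + k < t \<Longrightarrow> x \<in> P j \<Longrightarrow> y \<in> Q k \<Longrightarrow> rdot x y = 0"
    and t: "t > 0"
  shows "t + vec.dim W \<le> CARD('a)"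
proof -
  have sub: "vec.subspace W" "vec.subspace (P j)" "vec.subspace (Q j)" for j
    using W P Q by (auto simp: irreducible_QG_submodule_def QG_submodule_def)
  have PQ: "vec.dim (P j) + vec.dim (Q k) \<le> CARD('a)" if "j + k < t" for j k
    using dim_orthogonal3_le[of "P j" "Q k" "{0}"] sub orth[OF that] by simp
  \<comment> \<open>\<open>meets U\<close> means that \<open>U\<close> is not orthogonal to
    \<open>W\<close>; their intersection may be 0.\<close>
  define meets where "meets U \<longleftrightarrow> (\<exists>u\<in>U. \<exists>w\<in>W. rdot u w \<noteq> 0)" for U
  consider "\<exists>j<t. meets (P j)" | "meets (Q 0)" | "\<forall>j<t. \<not> meets (P j)" "\<not> meets (Q 0)"
    by blast
  then show ?thesis
  proof cases
    case 1
    define j where "j = (LEAST j. meets (P j))"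
    have j: "j < t" "meets (P j)"
      using 1 LeastI[of "\<lambda>j. meets (P j)"] Least_le[of "\<lambda>j. meets (P j)"]
      unfolding j_def by (metis le_less_trans, metis)
    obtain u w where uw: "u \<in> P j" "w \<in> W" "rdot u w \<noteq> 0"
      using j(2) unfolding meets_def by blast
    have "j + vec.dim W \<le> vec.dim (P j)"
    proof (cases j)
      case 0
      then show ?thesis
        using irreducible_dim_add_le[OF W P uw, of "{0}"] sub(2) by (auto simp: vec.subspace_0)
    next
      case (Suc i)
      \<comment> \<open>By minimality \<open>P i\<close> is orthogonal to \<open>W\<close> and can
        serve as \<open>K\<close>; \<open>P_dim\<close> gives it dimension at least
        \<open>i + 1 = j\<close>.\<close>
      then have "i < (LEAST j. meets (P j))"
        by (simp add: j_def)
      then have "\<not> meets (P i)"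
        by (rule not_less_Least)
      then have "vec.dim (P i) + vec.dim W \<le> vec.dim (P j)"
        using P_mono[of i] Suc sub
        by (intro irreducible_dim_add_le[OF W P uw]) (auto simp: meets_def)
      then show ?thesis
        using P_dim[of i] j Suc by simp
    qed
    \<comment> \<open>The indices add up to \<open>t - 1\<close>, the largest sum for which
      orthogonality is given.\<close>
    then show ?thesis
      using PQ[of j "t - 1 - j"] Q_dim[of "t - 1 - j"] j(1) by linarith
  next
    case 2
    then obtain u w where uw: "u \<in> Q 0" "w \<in> W" "rdot u w \<noteq> 0"
      unfolding meets_def by blast
    have "vec.dim W \<le> vec.dim (Q 0)"
      using irreducible_dim_add_le[OF W Q uw, of "{0}"] sub(3) by (auto simp: vec.subspace_0)
    then show ?thesis
      using PQ[of "t - 1" 0] P_dim[of "t - 1"] t by linarith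
  next
    case 3
    then have "\<not> meets (P (t - 1))" "\<not> meets (Q 0)"
      using t by simp_all
    then have "vec.dim (P (t - 1)) + vec.dim (Q 0) + vec.dim W \<le> CARD('a)"
      using t orth[of "t - 1" 0] by (intro dim_orthogonal3_le sub) (auto simp: meets_def)
    then show ?thesis
      using P_dim[of "t - 1"] Q_dim[of 0] t by linarith
  qed
qed

section \<open>Submodules generated by a set of vectors\<close>

definition Gspan :: "(rat ^ 'a) set \<Rightarrow> (rat ^ 'a) set" where
  "Gspan E = vec.span {perm_act g x |g x. g \<in> G \<and> x \<in> E}"

lemma Gspan_mono: "E \<subseteq> F \<Longrightarrow> Gspan E \<subseteq> Gspan F"
  unfolding Gspan_def by (intro vec.span_mono) blast

lemma dim_le_dim_Gspan: "vec.dim E \<le> vec.dim (Gspan E)"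
proof -
  have "E \<subseteq> {perm_act g x |g x. g \<in> G \<and> x \<in> E}"
    using id_mem by (force simp: perm_act_def)
  then show ?thesis
    unfolding Gspan_def using vec.span_superset by (intro vec.dim_subset) blast
qed

lemma QG_submodule_Gspan: "QG_submodule G (Gspan E)"
proof -
  let ?S = "{perm_act g x |g x. g \<in> G \<and> x \<in> E}"
  have "perm_act g ` ?S \<subseteq> ?S" if "g \<in> G" for g
    using that comp_mem by (fastforce simp: perm_act_comp)
  then have "perm_act g ` vec.span ?S \<subseteq> vec.span ?S" if "g \<in> G" for g
    unfolding vec.linear_span_image[OF linear_perm_act, symmetric]
    using that by (intro vec.span_mono)
  then show ?thesis
    unfolding QG_submodule_def Gspan_def using vec.subspace_span by blast
qed

text \<open>Moving \<open>g\<close> across turns \<open>rdot (perm_act g x) (perm_act h y)\<close>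
  into \<open>rdot x\<close> of one translate of \<open>y\<close>, so translates need testing on one
  side only.\<close>

lemma Gspan_orthogonal:
  assumes "\<And>g x y. g \<in> G \<Longrightarrow> x \<in> E \<Longrightarrow> y \<in> F \<Longrightarrow> rdot x (perm_act g y) = 0"
    and "x \<in> Gspan E" "y \<in> Gspan F"
  shows "rdot x y = 0"
proof (rule rdot_span_eq_0[OF _ assms(2,3)[unfolded Gspan_def]], clarify)
  fix g h x y assume *: "g \<in> G" "x \<in> E" "h \<in> G" "y \<in> F"
  have "rdot (perm_act g x) (perm_act h y) = rdot x (perm_act (inv_into UNIV g) (perm_act h y))"
    using rdot_perm_act_right[OF inv_mem[OF *(1)]] bij[OF *(1)] by (simp add: inv_inv_eq)
  then show "rdot (perm_act g x) (perm_act h y) = 0"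
    using assms(1) * comp_mem inv_mem by (simp add: perm_act_comp)
qed

section \<open>Enlarging preimages and building a reset word\<close>

lemma expanding_word:
  assumes W: "irreducible_QG_submodule G W"
    and short: "\<And>g. g \<in> G \<Longrightarrow> \<exists>w. set w \<subseteq> X \<and> length w \<le> d \<and> word_map w = g"
    and c: "set c \<subseteq> X" "\<And>x. word_map c x = p"
    and S: "S \<noteq> {}" "S \<noteq> UNIV"
  shows "\<exists>w. set w \<subseteq> X \<and> length w \<le> CARD('a) - vec.dim W + d \<and> card S < card (word_map w -` S)"
proof -
  define f :: "rat ^ 'a" where "f = (\<chi> x. of_bool (x \<in> S) - of_nat (card S) / of_nat CARD('a))"
  have card_S: "0 < card S" "card S < CARD('a)"
    using S by (auto simp: card_gt_0_iff intro: psubset_card_mono)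
  have f_nonzero: "f $ x \<noteq> 0" for x
    using card_S by (auto simp: f_def)
  have rdot_1: "rdot 1 h = sum (($) h) UNIV" for h :: "rat ^ 'a"
    by (simp add: rdot_def)
  have weight: "rdot 1 (perm_act (word_map w) f) = of_nat (card (word_map w -` S)) - of_nat (card S)"
    for w
    by (simp add: rdot_1 perm_act_def f_def sum_subtractf vimage_def)
  have perm_weight: "rdot 1 (perm_act g h) = rdot 1 h" if "g \<in> G" for g h
    using sum.reindex_bij_betw[OF bij[OF that], of "($) h"] by (simp add: rdot_1 perm_act_def)
  have perm_id: "perm_act id h = h" for h :: "rat ^ 'a"
    by (simp add: perm_act_def)
  define escape where
    "escape u g v \<longleftrightarrow> rdot (foldr push u 1) (perm_act g (foldr perm_act v f)) \<noteq> 0" for u g v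
  \<comment> \<open>\<open>c\<close> turns \<open>f\<close> into the constant function with value
    \<open>f $ p\<close>, whose entries have a nonzero sum.\<close>
  have reset: "rdot 1 (foldr perm_act c f) \<noteq> 0"
    using f_nonzero by (simp add: foldr_perm_act perm_act_def rdot_1 c(2))
  then have reset': "rdot (foldr push (rev c) 1) f \<noteq> 0"
    by (simp add: rdot_foldr_push)
  define esc where "esc t \<longleftrightarrow> (\<exists>u g v. set u \<subseteq> X \<and> set v \<subseteq> X \<and> g \<in> G \<and>
      length u + length v = t \<and> escape u g v)" for t
  define t where "t = (LEAST t. esc t)"
  \<comment> \<open>The reset word, put entirely on the \<open>u\<close> side, shows that the
    minimum \<open>t\<close> exists.\<close>
  have "esc (length c)"
    unfolding esc_def escape_def using c(1) reset' id_mem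
    by (intro exI[of _ "rev c"] exI[of _ id] exI[of _ "[]"]) (auto simp: perm_id)
  then have "esc t"
    unfolding t_def by (rule LeastI)
  then obtain u\<^sub>0 g\<^sub>0 v\<^sub>0 where esc0: "set u\<^sub>0 \<subseteq> X" "set v\<^sub>0 \<subseteq> X" "g\<^sub>0 \<in> G" "length u\<^sub>0 + length v\<^sub>0 = t"
      "escape u\<^sub>0 g\<^sub>0 v\<^sub>0"
    unfolding esc_def by blast
  have below: "rdot (foldr push u 1) (perm_act g (foldr perm_act v f)) = 0"
    if "set u \<subseteq> X" "set v \<subseteq> X" "g \<in> G" "length u + length v < t" for u g v
    using not_less_Least[of "length u + length v" esc] that
    unfolding t_def esc_def escape_def by blast
  \<comment> \<open>At total length 0 only permutations act, and they preserve the zero sum of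
    \<open>f\<close>.\<close>
  have t_pos: "t > 0"
  proof (rule ccontr)
    assume "\<not> t > 0"
    then have "rdot 1 (perm_act g\<^sub>0 f) \<noteq> 0"
      using esc0(4,5) by (simp add: escape_def)
    then show False
      using weight[of "[]"] perm_weight[OF esc0(3)]
      by (simp add: foldr_perm_act[of "[]", symmetric]) (simp add: word_map_def vimage_def)
  qed
  have "t + vec.dim W \<le> CARD('a)"
  proof (rule orthogonal_chains_bound[OF W])
    let ?P = "\<lambda>j. Gspan (reach push X 1 j)" and ?Q = "\<lambda>j. Gspan (reach perm_act X f j)"
    show "QG_submodule G (?P j)" "QG_submodule G (?Q j)" "?P j \<subseteq> ?P (Suc j)" for j
      by (simp_all add: QG_submodule_Gspan Gspan_mono reach_mono)
    show "t > 0" by (rule t_pos)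
    show "rdot x y = 0" if "j + k < t" "x \<in> ?P j" "y \<in> ?Q k" for j k x y
    proof (rule Gspan_orthogonal[OF _ that(2,3)])
      fix g x y assume "g \<in> G" "x \<in> reach push X 1 j" "y \<in> reach perm_act X f k"
      then show "rdot x (perm_act g y) = 0"
        using that(1) by (auto simp: reach_def intro!: below)
    qed
    show "j < vec.dim (?P j)" if "j < t" for j
    proof -
      \<comment> \<open>The complement of the orbit of \<open>f\<close>: by \<open>below\<close>
        with empty \<open>v\<close>, words of length at most \<open>j\<close> stay in it, while
        \<open>rev c\<close> leaves it, as \<open>less_dim_reach\<close> requires.\<close>
      let ?C = "{x. \<forall>y\<in>{perm_act g f |g. g \<in> G}. rdot x y = 0}"
      have "f \<in> {perm_act g f |g. g \<in> G}"
        using id_mem perm_id[of f] by (metis (mono_tags, lifting) mem_Collect_eq)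
      then have notin: "foldr push (rev c) 1 \<notin> ?C"
        using reset' by blast
      have "reach push X 1 j \<subseteq> ?C"
        using that below[of _ "[]"] by (auto simp: reach_def)
      moreover have "set (rev c) \<subseteq> X"
        using c(1) by simp
      ultimately have "j < vec.dim (reach push X 1 j)"
        using notin by (rule less_dim_reach[OF linear_push subspace_orthogonal_complement])
      then show ?thesis
        using dim_le_dim_Gspan less_le_trans by blast
    qed
    show "j < vec.dim (?Q j)" if "j < t" for j
    proof -
      \<comment> \<open>Dually, with empty \<open>u\<close>: short words keep the entry sum of
        \<open>f\<close> at 0, and \<open>c\<close> does not.\<close>
      let ?C = "{x. \<forall>y\<in>{1}. rdot x y = 0}"
      have notin: "foldr perm_act c f \<notin> ?C"
        using reset by (simp add: rdot_commute[of _ 1])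
      have "reach perm_act X f j \<subseteq> ?C"
        using that below[of "[]" _ id] id_mem by (auto simp: reach_def perm_id rdot_commute[of _ 1])
      from this c(1) notin have "j < vec.dim (reach perm_act X f j)"
        by (rule less_dim_reach[OF linear_perm_act subspace_orthogonal_complement])
      then show ?thesis
        using dim_le_dim_Gspan less_le_trans by blast
    qed
  qed
  \<comment> \<open>If \<open>u\<close> is empty, \<open>g\<close> can be dropped and the first letter of \<open>v\<close> moved to \<open>u\<close>.\<close>
  obtain u g v where esc: "set u \<subseteq> X" "set v \<subseteq> X" "g \<in> G" "length u + length v = t"
      "escape u g v" "length v < t"
  proof (cases u\<^sub>0)
    case Nil
    then obtain b v' where v0: "v\<^sub>0 = b # v'"
      using esc0(4) t_pos by (cases v\<^sub>0) auto
    have "rdot 1 (perm_act b (foldr perm_act v' f)) \<noteq> 0"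
      using esc0(5) perm_weight[OF esc0(3)] Nil v0 by (simp add: escape_def)
    then have "escape [b] id v'"
      by (simp add: escape_def rdot_push perm_id)
    then show ?thesis
      using that[of "[b]" v' id] esc0 id_mem Nil v0 by auto
  next
    case Cons
    then show ?thesis
      using that esc0 by (metis add_gr_0 length_greater_0_conv less_add_same_cancel2 list.discI)
  qed
  let ?l = "foldr push u 1" and ?h = "foldr perm_act v f"
  \<comment> \<open>Minimality of \<open>t\<close> applies because \<open>length v < t\<close>,
    which is why \<open>u\<close> was made nonempty.\<close>
  have "sum (($) ?h) UNIV = 0"
    using below[of "[]" v id] esc(2,6) id_mem by (simp add: perm_id rdot_1)
  then have "(\<Sum>k\<in>G. ?h $ k x) = 0" for x
    by (rule sum_perm_act_eq_0)
  moreover have "(\<Sum>k\<in>G. rdot ?l (perm_act k ?h)) = (\<Sum>i\<in>UNIV. ?l $ i * (\<Sum>k\<in>G. ?h $ k i))"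
    unfolding rdot_def perm_act_def sum_distrib_left by (subst sum.swap) simp
  ultimately have "(\<Sum>k\<in>G. rdot ?l (perm_act k ?h)) = 0"
    by simp
  then obtain k where k: "k \<in> G" "rdot ?l (perm_act k ?h) > 0"
    using sum_nonneg_eq_0_iff[of G "\<lambda>k. - rdot ?l (perm_act k ?h)"] esc(3,5)
    unfolding escape_def by (force simp: sum_negf not_less)
  obtain w where w: "set w \<subseteq> X" "length w \<le> d" "word_map w = k"
    using short[OF k(1)] by blast
  \<comment> \<open>\<open>rev u\<close> undoes the transposition in \<open>push\<close>, and
    \<open>w\<close> spells out \<open>k\<close>.\<close>
  let ?w = "rev u @ w @ v"
  have "rdot 1 (perm_act (word_map ?w) f) > 0"
    using k(2) unfolding w(3)[symmetric] by (simp add: rdot_foldr_push flip: foldr_perm_act)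
  then have "card S < card (word_map ?w -` S)"
    unfolding weight by simp
  moreover have "set ?w \<subseteq> X" "length ?w \<le> CARD('a) - vec.dim W + d"
    using esc w \<open>t + vec.dim W \<le> CARD('a)\<close> by auto
  ultimately show ?thesis by blast
qed

text \<open>A noninjective letter gives a point with two preimages; each of at most
  \<open>CARD('a) - 2\<close> enlargements then adds at least one point.\<close>

lemma short_reset_word:
  assumes W: "irreducible_QG_submodule G W"
    and short: "\<And>g. g \<in> G \<Longrightarrow> \<exists>w. set w \<subseteq> X \<and> length w \<le> d \<and> word_map w = g"
    and c: "set c \<subseteq> X" "\<And>x. word_map c x = q"
    and n: "CARD('a) \<ge> 2"
  shows "\<exists>w. reset_word X w \<and> length w \<le> 1 + (CARD('a) - vec.dim W + d) * (CARD('a) - 2)"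
proof -
  let ?K = "CARD('a) - vec.dim W + d"
  \<comment> \<open>If all letters were injective, so would be the constant map of
    \<open>c\<close>.\<close>
  have "\<exists>b\<in>X. \<not> inj b"
  proof (rule ccontr)
    assume inj: "\<not> (\<exists>b\<in>X. \<not> inj b)"
    have "inj (word_map w)" if "set w \<subseteq> X" for w
      using that
    proof (induction w)
      case (Cons b w)
      have "word_map (b # w) = word_map w \<circ> b"
        by (auto simp: word_map_def)
      then show ?case
        using Cons inj inj_compose[of "word_map w" b] by (metis insert_subset list.simps(15))
    qed (simp add: word_map_def[abs_def])
    then have "inj (word_map c)"
      using c(1) by blast
    then have "x = y" for x y :: 'a
      using c(2) by (simp add: inj_def)
    then have "CARD('a) \<le> 1"
      by (simp add: card_le_Suc0_iff_eq)
    then show False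
      using n by simp
  qed
  then obtain b x y where b: "b \<in> X" "b x = b y" "x \<noteq> y"
    by (auto simp: inj_def)
  define p where "p = b y"
  \<comment> \<open>The first letter accounts for the 1 and its two points for \<open>i + 2\<close>;
    \<open>min\<close> lets \<open>w\<close> stay unchanged once the preimage is everything.\<close>
  have "\<exists>w. set w \<subseteq> X \<and> length w \<le> 1 + i * ?K \<and> min CARD('a) (i + 2) \<le> card (word_map w -` {p})" for i
  proof (induction i)
    case 0
    have "card {x, y} \<le> card (word_map [b] -` {p})"
      using b(2) by (intro card_mono) (auto simp: word_map_def p_def)
    then show ?case
      using b by (intro exI[of _ "[b]"]) auto
  next
    case (Suc i)
    then obtain w where w: "set w \<subseteq> X" "length w \<le> 1 + i * ?K"
        "min CARD('a) (i + 2) \<le> card (word_map w -` {p})"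
      by blast
    show ?case
    proof (cases "word_map w -` {p} = UNIV")
      case True
      then show ?thesis
        using w by (intro exI[of _ w]) auto
    next
      case False
      have "word_map w -` {p} \<noteq> {}"
        using w(3) n by auto
      then obtain v where v: "set v \<subseteq> X" "length v \<le> ?K"
          "card (word_map w -` {p}) < card (word_map v -` (word_map w -` {p}))"
        using expanding_word[OF W short c _ False] by blast
      moreover have "word_map v -` (word_map w -` {p}) = word_map (v @ w) -` {p}"
        by (auto simp: word_map_def)
      ultimately show ?thesis
        using w by (intro exI[of _ "v @ w"]) auto
    qed
  qed
  from this[of "CARD('a) - 2"] obtain w where w: "set w \<subseteq> X"
      "length w \<le> 1 + (CARD('a) - 2) * ?K" "CARD('a) \<le> card (word_map w -` {p})"
    using n by auto
  then have "word_map w -` {p} = UNIV"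
    by (intro card_seteq) auto
  then have "word_map w x = p" for x
    by blast
  then have "reset_word X w"
    using w(1) by (auto simp: reset_word_def constant_on_def)
  then show ?thesis
    using w(2) by (auto simp: mult.commute)
qed

end

section \<open>From the given notions to the final bound\<close>

lemma transitive_perms_if_transitive_perm_group:
  assumes "transitive_perm_group G"
  shows "transitive_perms G"
proof
  have G: "subgroup G (BijGroup UNIV)"
    and trans: "transitive_action (BijGroup UNIV\<lparr>carrier := G\<rparr>) UNIV (\<lambda>g. g)"
    using assms by (auto simp: transitive_perm_group_def)
  show bij: "bij g" if "g \<in> G" for g
    using subgroup.subset[OF G] that by (auto simp: BijGroup_def Bij_def)
  show "id \<in> G"
    using subgroup.one_closed[OF G] by (simp add: BijGroup_def id_def restrict_UNIV)
  show "g \<circ> f \<in> G" if "g \<in> G" "f \<in> G" for g f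
    using subgroup.m_closed[OF G that] bij that
    by (simp add: BijGroup_def Bij_def compose_def o_def restrict_UNIV)
  show "inv_into UNIV g \<in> G" if "g \<in> G" for g
    using subgroup.m_inv_closed[OF G that] bij[OF that]
    by (simp add: inv_BijGroup Bij_def restrict_UNIV)
  show "\<exists>g\<in>G. g x = y" for x y
    using transitive_action.unique_orbit[OF trans, of x y] by simp
qed

text \<open>Identity letters only pad words to the exact length \<open>d\<close>; deleting them
  keeps the product.\<close>

lemma short_word_if_word_power:
  assumes "g \<in> word_power A d"
  shows "\<exists>w. set w \<subseteq> A \<and> length w \<le> d \<and> word_map w = g"
proof -
  obtain w where w: "length w = d" "set w \<subseteq> A \<union> {id}" "g = word_map w"
    using assms by (auto simp: word_power_def)
  have "word_map (filter (\<lambda>a. a \<noteq> id) w) = word_map w"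
    by (rule ext, induction w) (auto simp: word_map_def)
  then show ?thesis
    using w length_filter_le by (intro exI[of _ "filter (\<lambda>a. a \<noteq> id) w"]) auto
qed

text \<open>With \<open>X\<close> as \<open>A \<union> B\<close> it supplies some reset word
  \<open>c\<close>, of uncontrolled length.\<close>

lemma gen_monoid_imp_word:
  assumes "f \<in> gen_monoid Y" "\<And>y. y \<in> Y \<Longrightarrow> \<exists>w. set w \<subseteq> X \<and> word_map w = y"
  shows "\<exists>w. set w \<subseteq> X \<and> word_map w = f"
  using assms(1)
proof induction
  case one
  then show ?case
    by (intro exI[of _ "[]"]) (auto simp: word_map_def)
next
  case (mult f g)
  then obtain v w where "set v \<subseteq> X" "word_map v = f" "set w \<subseteq> X" "word_map w = g"
    by blast
  then show ?case
    by (intro exI[of _ "v @ w"]) (auto simp: word_map_def)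
qed (rule assms(2))

theorem theorem9p2:
  fixes G A B :: "('a::finite \<Rightarrow> 'a) set"
  assumes "CARD('a) \<ge> 2"
    and "transitive_perm_group G"
    and "generate (BijGroup UNIV) A = G"
    and "synchronizing (gen_monoid (G \<union> B))"
  shows "(\<exists>w. reset_word (A \<union> B) w \<and>
            int (length w) \<le> 1 + (int CARD('a) - int (max_irreducible_dim G) + int (gen_diameter A G))
                                 * (int CARD('a) - 2)) \<and>
         (max_irreducible_dim G \<ge> gen_diameter A G \<longrightarrow>
           (\<exists>w. reset_word (A \<union> B) w \<and> int (length w) \<le> (int CARD('a) - 1)^2))"
proof -
  interpret transitive_perms G
    by (rule transitive_perms_if_transitive_perm_group[OF assms(2)])
  let ?n = "CARD('a)" and ?m = "max_irreducible_dim G" and ?d = "gen_diameter A G"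
  have "?m \<in> {vec.dim W |W. irreducible_QG_submodule G W}"
    unfolding max_irreducible_dim_def by (intro Max_in max_irreducible_dim)
  then obtain W where W: "irreducible_QG_submodule G W" "vec.dim W = ?m"
    by auto
  then have m: "?m \<le> ?n"
    using dim_subset_UNIV_cart_gen by metis
  have "G = word_power A ?d"
    using assms(2,3) by (intro gen_diameter) (auto simp: transitive_perm_group_def)
  then have short: "\<exists>w. set w \<subseteq> A \<union> B \<and> length w \<le> ?d \<and> word_map w = g" if "g \<in> G" for g
    using short_word_if_word_power that by (metis le_supI1)
  have letter: "\<exists>w. set w \<subseteq> A \<union> B \<and> word_map w = y" if "y \<in> G \<union> B" for y
  proof (cases "y \<in> G")
    case False
    then show ?thesis
      using that by (intro exI[of _ "[y]"]) (auto simp: word_map_def)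
  qed (use short in blast)
  obtain f where f: "f \<in> gen_monoid (G \<union> B)" "card (range f) = 1"
    using assms(4) by (auto simp: synchronizing_def)
  then obtain q where "range f = {q}"
    by (auto simp: card_1_singleton_iff)
  then have q: "f x = q" for x
    by blast
  obtain c where "set c \<subseteq> A \<union> B" "word_map c = f"
    using gen_monoid_imp_word[OF f(1) letter] by blast
  then obtain w where w: "reset_word (A \<union> B) w" "length w \<le> 1 + (?n - ?m + ?d) * (?n - 2)"
    using short_reset_word[OF W(1) short, of c q] q assms(1) W(2) by auto
  \<comment> \<open>Subtraction of natural numbers is exact here, as \<open>?m \<le> ?n\<close> and
    \<open>?n \<ge> 2\<close>.\<close>
  have len: "int (length w) \<le> 1 + (int ?n - int ?m + int ?d) * (int ?n - 2)"
  proof -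
    have "int (1 + (?n - ?m + ?d) * (?n - 2)) = 1 + (int ?n - int ?m + int ?d) * (int ?n - 2)"
      using m assms(1) by (simp add: of_nat_diff)
    then show ?thesis
      using w(2) by linarith
  qed
  \<comment> \<open>With \<open>?d \<le> ?m\<close> the first factor is at most \<open>?n\<close>,
    and \<open>1 + n * (n - 2) = (n - 1)^2\<close>.\<close>
  moreover have "int (length w) \<le> (int ?n - 1)^2" if "?d \<le> ?m"
  proof -
    have "(int ?n - int ?m + int ?d) * (int ?n - 2) \<le> int ?n * (int ?n - 2)"
      using that assms(1) by (intro mult_right_mono) auto
    then show ?thesis
      using len by (simp add: power2_eq_square algebra_simps)
  qed
  ultimately show ?thesis
    using w(1) by blast
qed

end
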